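(* Let $\Gamma$ be a family of 1-regular digraphs all having the same vertex set $V$, $|V|=n$, each identified with a permutation of $V$. Let $C_m^+$ have vertices $a_1,\dots,a_m$ and arcs $(a_i,a_{i+1})$ ($1\le i\le m-1$) and $(a_m,a_1)$, let $h:E(C_m^+)\to\Gamma$ be any function, and let $P_h=h(a_ma_1)\cdots h(a_2a_3)\cdot h(a_1a_2)$ (composition, with $h(a_1a_2)$ applied first). Let $\sigma_1\cdots\sigma_s$ be the disjoint cyclic decomposition of $P_h$ (including cycles of length $1$), and $|\sigma_j|$ the length of $\sigma_j$. Then every cycle in the disjoint cyclic decomposition of $P_h$ corresponds to a strongly connected component of $C_m^+\otimes_h\Gamma$, and the component corresponding to $\sigma_j$ is a strongly oriented cycle of length $m|\sigma_j|$. That is, $$C_m^+\otimes_h\Gamma\cong C^+_{m|\sigma_1|}+C^+_{m|\sigma_2|}+\cdots+C^+_{m|\sigma_s|}.$$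
   Context: A 1-regular digraph $F$ on $V$ (all in- and out-degrees $1$) is identified with the permutation $\pi$ of $V$ with $\pi(x)=y$ iff $(x,y)\in E(F)$. Product: for a digraph $D$, a family $\Gamma$ of digraphs with common vertex set $V$ and $h:E(D)\to\Gamma$, $D\otimes_h\Gamma$ has vertex set $V(D)\times V$ and $((a,x),(b,y))$ is an arc iff $(a,b)\in E(D)$ and $(x,y)\in E(h(a,b))$. $C_k^+$ denotes a strongly oriented cycle of length $k$ and $+$ denotes disjoint union. *)

theory Defs
  imports "Graph_Theory.Graph_Theory" "HOL-Combinatorics.Cycles"
begin

text \<open>
  Digraphs here may have loops but no parallel arcs, so they are represented by
  \<open>pair_pre_digraph\<close>; \<open>with_proj\<close> embeds them into the general digraphs for which
  degrees, strong components and isomorphism are defined.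
\<close>

definition one_regular :: "'v pair_pre_digraph \<Rightarrow> bool" where
  "one_regular F \<longleftrightarrow> pair_wf_digraph F \<and>
     (\<forall>x \<in> pverts F. in_degree (with_proj F) x = 1 \<and> out_degree (with_proj F) x = 1)"

text \<open>The identity outside the vertex set, so that the result \<open>permutes\<close> the vertex set.\<close>
definition perm_of :: "'v pair_pre_digraph \<Rightarrow> 'v \<Rightarrow> 'v" where
  "perm_of F x = (if x \<in> pverts F then THE y. (x, y) \<in> parcs F else x)"

text \<open>\<open>V\<close> is the common vertex set of the digraphs that are values of \<open>h\<close>.\<close>
definition otimes_digraph ::
  "'a pair_pre_digraph \<Rightarrow> 'v set \<Rightarrow> ('a \<times> 'a \<Rightarrow> 'v pair_pre_digraph) \<Rightarrow> ('a \<times> 'v) pair_pre_digraph" where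
  "otimes_digraph D V h =
     \<lparr> pverts = pverts D \<times> V,
       parcs = {((a, x), (b, y)) | a x b y. (a, b) \<in> parcs D \<and> (x, y) \<in> parcs (h (a, b))} \<rparr>"

text \<open>
  The arcs of the cycle through \<open>a 1, \<dots>, a m\<close>, in cyclic order.
  For \<open>m = 1\<close> the only arc is the loop at \<open>a 1\<close>; only \<open>m \<ge> 1\<close> is meaningful.
\<close>
definition cycle_arcs :: "nat \<Rightarrow> (nat \<Rightarrow> 'a) \<Rightarrow> ('a \<times> 'a) list" where
  "cycle_arcs m a = map (\<lambda>i. (a i, a (i + 1))) [1..<m] @ [(a m, a 1)]"

definition oriented_cycle_on :: "nat \<Rightarrow> (nat \<Rightarrow> 'a) \<Rightarrow> 'a pair_pre_digraph" where
  "oriented_cycle_on m a = \<lparr> pverts = a ` {1..m}, parcs = set (cycle_arcs m a) \<rparr>"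

definition oriented_cycle :: "nat \<Rightarrow> nat pair_pre_digraph" where
  "oriented_cycle k = oriented_cycle_on k (\<lambda>i. i)"

text \<open>\<open>h(a\<^sub>m a\<^sub>1) \<circ> \<dots> \<circ> h(a\<^sub>2 a\<^sub>3) \<circ> h(a\<^sub>1 a\<^sub>2)\<close>: the first arc is applied first.\<close>
definition cycle_perm :: "nat \<Rightarrow> (nat \<Rightarrow> 'a) \<Rightarrow> ('a \<times> 'a \<Rightarrow> 'v pair_pre_digraph) \<Rightarrow> 'v \<Rightarrow> 'v" where
  "cycle_perm m a h = fold (\<lambda>e p. perm_of (h e) \<circ> p) (cycle_arcs m a) id"

text \<open>
  A cycle \<open>(x\<^sub>1 \<dots> x\<^sub>r)\<close> is given by the list of its elements. Fixed points of \<open>p\<close>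
  in \<open>V\<close> appear as lists of length one, because the lists cover \<open>V\<close>.
\<close>
definition cyclic_decomposition :: "'v set \<Rightarrow> ('v \<Rightarrow> 'v) \<Rightarrow> 'v list list \<Rightarrow> bool" where
  "cyclic_decomposition V p \<sigma> \<longleftrightarrow>
     (\<forall>c \<in> set \<sigma>. c \<noteq> []) \<and> distinct (concat \<sigma>) \<and> set (concat \<sigma>) = V \<and>
     p = foldr (\<circ>) (map cycle_of_list \<sigma>) id"

definition disjoint_sum :: "'a pair_pre_digraph list \<Rightarrow> (nat \<times> 'a) pair_pre_digraph" where
  "disjoint_sum Gs =
     \<lparr> pverts = {(j, u) | j u. j < length Gs \<and> u \<in> pverts (Gs ! j)},
       parcs = {((j, u), (j, v)) | j u v. j < length Gs \<and> (u, v) \<in> parcs (Gs ! j)} \<rparr>"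

lemma one_regular_arc_iff:
  assumes "one_regular F"
  shows "(x, y) \<in> parcs F \<longleftrightarrow> x \<in> pverts F \<and> perm_of F x = y"
proof -
  have wf: "pair_wf_digraph F"
    and deg: "\<And>x. x \<in> pverts F \<Longrightarrow> card {e \<in> parcs F. fst e = x} = 1"
    using assms by (auto simp: one_regular_def out_degree_def out_arcs_def)
  have ex1: "\<exists>!y. (x, y) \<in> parcs F" if x: "x \<in> pverts F" for x
  proof -
    from deg[OF x] obtain e where e: "{e \<in> parcs F. fst e = x} = {e}"
      by (metis card_1_singletonE)
    then have eF: "e \<in> parcs F" "fst e = x" by blast+
    show ?thesis
    proof (rule ex1I[of _ "snd e"])
      show "(x, snd e) \<in> parcs F" using eF by (cases e) auto
      fix y assume "(x, y) \<in> parcs F"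
      then have "(x, y) \<in> {e}" unfolding e[symmetric] by simp
      then show "y = snd e" by auto
    qed
  qed
  show ?thesis
  proof
    assume arc: "(x, y) \<in> parcs F"
    then have x: "x \<in> pverts F" using pair_wf_digraph.in_arcsD1[OF wf] by blast
    then show "x \<in> pverts F \<and> perm_of F x = y"
      using the1_equality[OF ex1[OF x] arc] by (simp add: perm_of_def)
  next
    assume "x \<in> pverts F \<and> perm_of F x = y"
    then show "(x, y) \<in> parcs F"
      using theI'[OF ex1] by (auto simp: perm_of_def)
  qed
qed

lemma cyclic_decomposition_exists:
  assumes "p permutes V" "finite V"
  shows "\<exists>\<sigma>. cyclic_decomposition V p \<sigma>"
  using cycle_decomposition[OF assms]
proof induction
  case empty
  show ?case by (rule exI[of _ "[]"]) (simp add: cyclic_decomposition_def id_def)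
next
  case (comp I p cs)
  then obtain \<sigma> where \<sigma>: "cyclic_decomposition I p \<sigma>" by blast
  show ?case
  proof (cases "cs = []")
    case True
    then show ?thesis using \<sigma> by auto
  next
    case False
    then have "cyclic_decomposition (set cs \<union> I) (cycle_of_list cs \<circ> p) (cs # \<sigma>)"
      using \<sigma> comp.hyps by (auto simp: cyclic_decomposition_def)
    then show ?thesis by blast
  qed
qed

end

theory Submission
  imports Defs
begin

text \<open>
  Let \<open>Q k\<close> be the composition of the permutations on the first \<open>k\<close> arcs of the cycle. Starting
  at \<open>(a 1, y)\<close>, the walk in the product passes through \<open>(a (k + 1), Q k y)\<close> for \<open>k < m\<close> and then
  returns to \<open>(a 1, P y)\<close> with \<open>P = Q m\<close>. So after \<open>w\<close> steps from \<open>(a 1, x\<^sub>0)\<close>, where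
  \<open>(x\<^sub>0 \<dots> x\<^sub>r\<^sub>-\<^sub>1)\<close> is a cycle of \<open>P\<close>, the walk is at
  \<open>(a (w mod m + 1), Q (w mod m) x\<^sub>t)\<close> with \<open>t = w div m mod r\<close>, and it closes up after exactly
  \<open>m * r\<close> steps. Since every \<open>Q k\<close> is a permutation of \<open>V\<close>, each vertex of the product has
  exactly one such description, hence the product is isomorphic to the disjoint sum of these
  closed walks.
\<close>

section \<open>Isomorphisms and strong components of digraphs\<close>

text \<open>Arcs are pairs of vertices, so \<open>f\<close> already determines the arc map
  \<open>map_prod f f\<close>. Its injectivity on arcs follows from that of \<open>f\<close>,
  because well-formedness puts both ends of every arc in \<open>pverts G\<close>.\<close>

lemma digraph_iso_with_projI:
  assumes "pair_wf_digraph G" and "bij_betw f (pverts G) (pverts H)"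
    and "parcs H = map_prod f f ` parcs G"
  shows "digraph_iso (with_proj G) (with_proj H)"
proof -
  interpret pair_wf_digraph G by (rule assms(1))
  let ?f = "\<lparr>iso_verts = f, iso_arcs = map_prod f f, iso_head = snd, iso_tail = fst\<rparr>"
  have inj: "inj_on f (pverts G)" using assms(2) by (rule bij_betw_imp_inj_on)
  have "parcs G \<subseteq> pverts G \<times> pverts G" by (auto dest: wellformed')
  then have "inj_on (map_prod f f) (parcs G)"
    using map_prod_inj_on[OF inj inj] by (rule inj_on_subset[rotated])
  then have "pre_digraph.digraph_isomorphism (with_proj G) ?f"
    using inj wf_digraph by (auto simp: pre_digraph.digraph_isomorphism_def)
  moreover have "with_proj H = app_iso ?f (with_proj G)"
    using assms(2,3) by (simp add: app_iso_def with_proj_def bij_betw_def)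
  ultimately show ?thesis unfolding digraph_iso_def by blast
qed

text \<open>No walk leaves a set \<open>S j\<close>, and inside it any two vertices reach each
  other, so the sets \<open>S j\<close> are exactly the classes of mutual reachability. Distinct
  indices give distinct components because the \<open>S j\<close> are disjoint and nonempty and an
  induced subgraph determines its vertex set.\<close>

lemma (in wf_digraph) bij_betw_sccs:
  assumes verts: "verts G = (\<Union>j\<in>J. S j)" and disj: "disjoint_family_on S J"
    and nonempty: "\<And>j. j \<in> J \<Longrightarrow> S j \<noteq> {}"
    and closed: "\<And>j u v. j \<in> J \<Longrightarrow> u \<in> S j \<Longrightarrow> u \<rightarrow> v \<Longrightarrow> v \<in> S j"
    and conn: "\<And>j u v. j \<in> J \<Longrightarrow> u \<in> S j \<Longrightarrow> v \<in> S j \<Longrightarrow> u \<rightarrow>\<^sup>* v"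
  shows "bij_betw (\<lambda>j. G \<restriction> S j) J sccs"
proof -
  have closed': "v \<in> S j" if "u \<rightarrow>\<^sup>* v" "j \<in> J" "u \<in> S j" for u v j
    using that by (induction rule: reachable_induct) (auto intro: closed)
  have "T \<in> S ` J" if T: "T \<in> sccs_verts" for T
  proof -
    obtain u where u: "u \<in> T" using T unfolding sccs_verts_def by blast
    then have "u \<in> verts G" using T reachable_in_verts(1) unfolding sccs_verts_def by blast
    then obtain j where j: "j \<in> J" "u \<in> S j" using verts by blast
    have "v \<in> T" if "v \<in> S j" for v
      using T u conn[OF j that] conn[OF j(1) that j(2)] unfolding sccs_verts_def by blast
    moreover have "v \<in> S j" if "v \<in> T" for v
      using T u that closed'[OF _ j] unfolding sccs_verts_def by blast
    ultimately show ?thesis using j by blast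
  qed
  moreover have "S j \<in> sccs_verts" if "j \<in> J" for j
    using that nonempty conn closed' unfolding sccs_verts_def by blast
  ultimately have "sccs_verts = S ` J" by blast
  then have "sccs = (\<lambda>j. G \<restriction> S j) ` J"
    unfolding sccs_conv_sccs_verts by (simp add: image_image)
  moreover have "inj_on (\<lambda>j. G \<restriction> S j) J"
  proof (rule inj_onI)
    fix i j assume "i \<in> J" "j \<in> J" "G \<restriction> S i = G \<restriction> S j"
    moreover from this(3) have "S i = S j" by (metis induce_subgraph_verts)
    ultimately show "i = j" using disj nonempty by (metis disjoint_family_onD inf.idem)
  qed
  ultimately show ?thesis by (simp add: bij_betw_def)
qed

section \<open>Disjoint sums of digraphs\<close>

lemma image_Sigma_conv_UN: "(\<lambda>(j, w). g j w) ` Sigma A B = (\<Union>j\<in>A. g j ` B j)"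
  by force

lemma pverts_disjoint_sum:
  "pverts (disjoint_sum Gs) = (\<Union>j<length Gs. Pair j ` pverts (Gs ! j))"
  unfolding disjoint_sum_def by auto

lemma parcs_disjoint_sum:
  "parcs (disjoint_sum Gs) = (\<Union>j<length Gs. map_prod (Pair j) (Pair j) ` parcs (Gs ! j))"
  unfolding disjoint_sum_def by force

lemma pair_wf_disjoint_sum:
  assumes "\<And>j. j < length Gs \<Longrightarrow> pair_wf_digraph (Gs ! j)"
  shows "pair_wf_digraph (disjoint_sum Gs)"
  by unfold_locales
    (auto simp: disjoint_sum_def dest: pair_wf_digraph.wellformed'[OF assms])

text \<open>No arc joins two different summands and each summand is strongly connected, so the
  images of the summands satisfy the conditions of \<open>bij_betw_sccs\<close>. An explicit \<Phi>
  keeps the vertex set of each component known, which is needed to match components with cycles of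
  the permutation.\<close>

lemma sccs_of_disjoint_sum_image:
  assumes wf: "\<And>j. j < length Gs \<Longrightarrow> pair_wf_digraph (Gs ! j)"
    and sc: "\<And>j. j < length Gs \<Longrightarrow> strongly_connected (with_proj (Gs ! j))"
    and \<Phi>: "bij_betw \<Phi> (pverts (disjoint_sum Gs)) (pverts H)"
    and arcs: "parcs H = map_prod \<Phi> \<Phi> ` parcs (disjoint_sum Gs)"
  defines "K \<equiv> \<lambda>j. with_proj H \<restriction> (\<lambda>u. \<Phi> (j, u)) ` pverts (Gs ! j)"
  shows "bij_betw K {..<length Gs} (pre_digraph.sccs (with_proj H))"
    and "\<And>j. j < length Gs \<Longrightarrow> digraph_iso (K j) (with_proj (Gs ! j))"
proof -
  define S where "S \<equiv> \<lambda>j. (\<lambda>u. \<Phi> (j, u)) ` pverts (Gs ! j)"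
  have in_Gs: "u \<in> pverts (Gs ! j)" "v \<in> pverts (Gs ! j)"
    if "(u, v) \<in> parcs (Gs ! j)" "j < length Gs" for j u v
    using pair_wf_digraph.wellformed'[OF wf] that by blast+
  have \<Phi>_eq: "\<Phi> (i, u) = \<Phi> (j, v) \<longleftrightarrow> i = j \<and> u = v"
    if "i < length Gs" "u \<in> pverts (Gs ! i)" "j < length Gs" "v \<in> pverts (Gs ! j)" for i j u v
    using inj_on_eq_iff[OF bij_betw_imp_inj_on[OF \<Phi>], of "(i, u)" "(j, v)"] that
    by (simp add: disjoint_sum_def)
  have pverts_H: "pverts H = (\<Union>j\<in>{..<length Gs}. S j)"
    unfolding bij_betw_imp_surj_on[OF \<Phi>, symmetric] by (auto simp: disjoint_sum_def S_def)
  have arcs_H: "(x, y) \<in> parcs H \<longleftrightarrow>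
      (\<exists>j u v. j < length Gs \<and> (u, v) \<in> parcs (Gs ! j) \<and> x = \<Phi> (j, u) \<and> y = \<Phi> (j, v))" for x y
    unfolding arcs disjoint_sum_def by force
  interpret H: pair_wf_digraph H
    by unfold_locales (fastforce simp: arcs_H pverts_H S_def dest: in_Gs)+
  \<comment> \<open>An induced subgraph takes all arcs of \<open>H\<close> within
    \<open>S j\<close>; injectivity of \<Phi> shows that each of them comes from an arc of summand
    \<open>j\<close> itself.\<close>
  have arc_S: "(u, v) \<in> parcs (Gs ! j)"
    if e: "(\<Phi> (j, u), \<Phi> (j, v)) \<in> parcs H"
      and ju: "j < length Gs" "u \<in> pverts (Gs ! j)" "v \<in> pverts (Gs ! j)"
    for j u v
  proof -
    obtain i u' v' where *: "i < length Gs" "(u', v') \<in> parcs (Gs ! i)"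
      "\<Phi> (j, u) = \<Phi> (i, u')" "\<Phi> (j, v) = \<Phi> (i, v')"
      using e unfolding arcs_H by blast
    then show ?thesis using \<Phi>_eq ju in_Gs[OF *(2,1)] by blast
  qed
  have reach: "\<Phi> (j, u) \<rightarrow>\<^sup>*\<^bsub>with_proj H\<^esub> \<Phi> (j, v)"
    if j: "j < length Gs" and uv: "u \<rightarrow>\<^sup>*\<^bsub>with_proj (Gs ! j)\<^esub> v" for j u v
  proof -
    interpret Gj: pair_wf_digraph "Gs ! j" using wf[OF j] .
    from uv show ?thesis
    proof (induction rule: Gj.reachable_induct)
      case base
      then have "\<Phi> (j, u) \<in> S j" by (simp add: S_def)
      then have "\<Phi> (j, u) \<in> pverts H" using j unfolding pverts_H by blast
      then show ?case by (rule H.reachable_refl)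
    next
      case (step x y)
      then have "(\<Phi> (j, x), \<Phi> (j, y)) \<in> parcs H" using j by (auto simp: arcs_H)
      with step show ?case by (auto intro: H.reachable_adj_trans)
    qed
  qed
  have "bij_betw (\<lambda>j. with_proj H \<restriction> S j) {..<length Gs} (pre_digraph.sccs (with_proj H))"
  proof (rule H.bij_betw_sccs)
    show "disjoint_family_on S {..<length Gs}"
      by (auto simp: disjoint_family_on_def S_def \<Phi>_eq)
    show "S j \<noteq> {}" if "j \<in> {..<length Gs}" for j
      using sc that by (auto simp: S_def strongly_connected_def)
    show "y \<in> S j" if j: "j \<in> {..<length Gs}" and x: "x \<in> S j" and xy: "(x, y) \<in> parcs H" for j x y
    proof -
      obtain i u v where *: "i < length Gs" "(u, v) \<in> parcs (Gs ! i)" "x = \<Phi> (i, u)" "y = \<Phi> (i, v)"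
        using xy unfolding arcs_H by blast
      then have "i = j" using x j \<Phi>_eq[OF *(1) in_Gs(1)[OF *(2,1)]] by (auto simp: S_def)
      then show ?thesis using *(4) in_Gs(2)[OF *(2,1)] by (simp add: S_def)
    qed
    show "u \<rightarrow>\<^sup>*\<^bsub>with_proj H\<^esub> v" if "j \<in> {..<length Gs}" "u \<in> S j" "v \<in> S j" for j u v
      using that sc by (auto simp: S_def strongly_connected_def intro!: reach)
  qed (fact pverts_H)
  then show "bij_betw K {..<length Gs} (pre_digraph.sccs (with_proj H))"
    by (simp add: K_def S_def)

  fix j assume j: "j < length Gs"
  interpret Gj: pair_wf_digraph "Gs ! j" using wf[OF j] .
  \<comment> \<open>Writing the induced subgraph as \<open>with_proj\<close> of a pair digraph makes
    \<open>digraph_iso_with_projI\<close> applicable.\<close>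
  let ?K = "\<lparr>pverts = S j, parcs = {e \<in> parcs H. fst e \<in> S j \<and> snd e \<in> S j}\<rparr>"
  have "K j = with_proj ?K"
    by (simp add: K_def S_def induce_subgraph_def with_proj_def)
  moreover have "digraph_iso (with_proj (Gs ! j)) (with_proj ?K)"
  proof (rule digraph_iso_with_projI)
    show "bij_betw (\<lambda>u. \<Phi> (j, u)) (pverts (Gs ! j)) (pverts ?K)"
      using j by (auto simp: bij_betw_def inj_on_def S_def \<Phi>_eq)
    show "parcs ?K = map_prod (\<lambda>u. \<Phi> (j, u)) (\<lambda>u. \<Phi> (j, u)) ` parcs (Gs ! j)"
    proof (intro equalityI subsetI)
      fix e assume "e \<in> parcs ?K"
      then obtain u v where "u \<in> pverts (Gs ! j)" "v \<in> pverts (Gs ! j)"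
        "e = (\<Phi> (j, u), \<Phi> (j, v))" "e \<in> parcs H"
        by (cases e) (auto simp: S_def)
      then show "e \<in> map_prod (\<lambda>u. \<Phi> (j, u)) (\<lambda>u. \<Phi> (j, u)) ` parcs (Gs ! j)"
        using arc_S j by (auto intro!: image_eqI[of _ _ "(u, v)"])
    next
      fix e assume "e \<in> map_prod (\<lambda>u. \<Phi> (j, u)) (\<lambda>u. \<Phi> (j, u)) ` parcs (Gs ! j)"
      then obtain u v where uv: "(u, v) \<in> parcs (Gs ! j)" and e: "e = (\<Phi> (j, u), \<Phi> (j, v))"
        by auto
      have "e \<in> parcs H" unfolding e arcs_H using uv j by blast
      then show "e \<in> parcs ?K" using in_Gs[OF uv j] by (simp add: e S_def)
    qed
  qed unfold_locales
  ultimately show "digraph_iso (K j) (with_proj (Gs ! j))"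
    by (simp add: digraph_iso_swap[OF Gj.wf_digraph])
qed

section \<open>Oriented cycles\<close>

text \<open>Counting from 0 turns the closing arc into the case \<open>i = m - 1\<close> of a single
  formula, in agreement with the remainder \<open>w mod m\<close> of the walk.\<close>

lemma cycle_arcs_conv:
  assumes "m \<ge> 1"
  shows "cycle_arcs m a = map (\<lambda>i. (a (Suc i), a (Suc (Suc i mod m)))) [0..<m]"
proof -
  obtain k where m: "m = Suc k" using assms by (cases m) auto
  have "[1..<m] = map Suc [0..<k]" by (simp add: m map_Suc_upt)
  then show ?thesis by (simp add: cycle_arcs_def m)
qed

lemma parcs_oriented_cycle_on:
  assumes "m \<ge> 1"
  shows "parcs (oriented_cycle_on m a) = (\<lambda>i. (a (Suc i), a (Suc (Suc i mod m)))) ` {..<m}"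
  by (simp add: oriented_cycle_on_def cycle_arcs_conv[OF assms] lessThan_atLeast0)

lemma pverts_oriented_cycle_on: "pverts (oriented_cycle_on m a) = (\<lambda>i. a (Suc i)) ` {..<m}"
proof -
  have "{1..m} = Suc ` {..<m}"
    by (simp add: lessThan_atLeast0 atLeastLessThanSuc_atLeastAtMost)
  then show ?thesis
    unfolding oriented_cycle_on_def by (simp add: image_image)
qed

lemma pair_wf_oriented_cycle:
  assumes "k \<ge> 1"
  shows "pair_wf_digraph (oriented_cycle k)"
  using assms unfolding oriented_cycle_def
  by unfold_locales (auto simp: parcs_oriented_cycle_on pverts_oriented_cycle_on)

lemma strongly_connected_oriented_cycle:
  assumes "k \<ge> 1"
  shows "strongly_connected (with_proj (oriented_cycle k))"
proof -
  interpret pair_wf_digraph "oriented_cycle k" using pair_wf_oriented_cycle[OF assms] .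
  have step: "Suc i \<rightarrow>\<^bsub>with_proj (oriented_cycle k)\<^esub> Suc (Suc i mod k)" if "i < k" for i
    using that assms by (simp add: oriented_cycle_def parcs_oriented_cycle_on)
  have reach: "Suc i \<rightarrow>\<^sup>*\<^bsub>with_proj (oriented_cycle k)\<^esub> Suc ((i + n) mod k)" if "i < k" for i n
  proof (induction n)
    case 0
    then show ?case
      using that reachable_refl[of "Suc i"] by (simp add: oriented_cycle_def pverts_oriented_cycle_on)
  next
    case (Suc n)
    then show ?case
      using step[of "(i + n) mod k"] assms reachable_adj_trans by (fastforce simp: mod_Suc_eq)
  qed
  \<comment> \<open>Walking \<open>k - i\<close> steps back to the start of the cycle and then
    \<open>j\<close> more covers both orders of \<open>i\<close> and \<open>j\<close>; the
    subtraction is exact since \<open>i < k\<close>.\<close>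
  have "Suc i \<rightarrow>\<^sup>*\<^bsub>with_proj (oriented_cycle k)\<^esub> Suc j" if "i < k" "j < k" for i j
    using reach[OF that(1), of "k - i + j"] that by simp
  moreover have "{..<k} \<noteq> {}" using assms by (auto simp: lessThan_empty_iff)
  ultimately show ?thesis
    unfolding strongly_connected_def by (auto simp: oriented_cycle_def pverts_oriented_cycle_on)
qed

section \<open>Permutations and their cyclic decompositions\<close>

text \<open>Out-degree 1 makes the arc set the graph of \<open>perm_of F\<close> on the vertices,
  in-degree 1 makes this map injective, and on a finite set it is then surjective.\<close>

lemma perm_of_permutes:
  assumes "one_regular F" and "finite (pverts F)"
  shows "perm_of F permutes pverts F"
proof (rule bij_imp_permutes)
  interpret pair_wf_digraph F using assms(1) by (simp add: one_regular_def)
  have into: "perm_of F x \<in> pverts F" if "x \<in> pverts F" for x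
    using that one_regular_arc_iff[OF assms(1), of x "perm_of F x"] by (auto dest: wellformed')
  have "inj_on (perm_of F) (pverts F)"
  proof (rule inj_onI)
    fix x y assume xy: "x \<in> pverts F" "y \<in> pverts F" "perm_of F x = perm_of F y"
    let ?A = "{e \<in> parcs F. snd e = perm_of F y}"
    have "card ?A = 1"
      using assms(1) into[OF xy(2)] by (auto simp: one_regular_def in_degree_def in_arcs_def)
    moreover have "(x, perm_of F y) \<in> ?A" "(y, perm_of F y) \<in> ?A"
      using xy by (auto simp: one_regular_arc_iff[OF assms(1)])
    ultimately show "x = y" by (metis card_1_singletonE prod.inject singletonD)
  qed
  then show "bij_betw (perm_of F) (pverts F) (pverts F)"
    using into assms(2) by (intro endo_inj_surj[THEN bij_betw_imageI[rotated]]) auto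
qed (simp add: perm_of_def)

text \<open>Applying the cycle to every entry of its own list rotates the list by one place.\<close>

lemma cycle_of_list_nth:
  assumes "distinct c" and "t < length c"
  shows "cycle_of_list c (c ! t) = c ! (Suc t mod length c)"
proof -
  have "map (cycle_of_list c) c = rotate1 c"
    using cyclic_rotation[OF assms(1), of 1] by simp
  then show ?thesis using assms(2) by (metis nth_map nth_rotate1)
qed

lemma foldr_cycle_of_list_outside:
  "x \<notin> set (concat \<sigma>) \<Longrightarrow> foldr (\<circ>) (map cycle_of_list \<sigma>) id x = x"
  by (induction \<sigma>) (auto simp: id_outside_supp)

text \<open>Factors applied before \<open>c\<close> fix \<open>x\<close>, and factors applied after
  \<open>c\<close> fix the image of \<open>x\<close>, which still lies in \<open>set c\<close>: the
  lists are pairwise disjoint.\<close>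

lemma foldr_cycle_of_list:
  assumes "distinct (concat \<sigma>)" and "c \<in> set \<sigma>" and "x \<in> set c"
  shows "foldr (\<circ>) (map cycle_of_list \<sigma>) id x = cycle_of_list c x"
  using assms
proof (induction \<sigma>)
  case (Cons d \<sigma>)
  let ?p = "foldr (\<circ>) (map cycle_of_list \<sigma>) id"
  have "foldr (\<circ>) (map cycle_of_list (d # \<sigma>)) id = cycle_of_list d \<circ> ?p" by simp
  moreover have "cycle_of_list d (?p x) = cycle_of_list c x"
  proof (cases "c = d")
    case True
    with Cons.prems have "x \<notin> set (concat \<sigma>)" by auto
    then have "?p x = x" by (rule foldr_cycle_of_list_outside)
    then show ?thesis using True by metis
  next
    case False
    with Cons.prems have "?p x = cycle_of_list c x" by (intro Cons.IH) auto
    moreover have "cycle_of_list c x \<in> set c"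
      using permutes_in_image[OF cycle_permutes] Cons.prems by metis
    then have "cycle_of_list c x \<notin> set d" using Cons.prems False by auto
    then have "cycle_of_list d (cycle_of_list c x) = cycle_of_list c x" by (rule id_outside_supp)
    ultimately show ?thesis by metis
  qed
  ultimately show ?case by (metis comp_apply)
qed simp

text \<open>Turns the product formula for \<open>p\<close> into arithmetic on list positions, the
  form needed to follow the walk.\<close>

lemma cyclic_decomposition_nth:
  assumes "cyclic_decomposition V p \<sigma>" and "j < length \<sigma>" and "t < length (\<sigma> ! j)"
  shows "p (\<sigma> ! j ! t) = \<sigma> ! j ! (Suc t mod length (\<sigma> ! j))"
proof -
  have "distinct (concat \<sigma>)" and p: "p = foldr (\<circ>) (map cycle_of_list \<sigma>) id"
    using assms(1) by (auto simp: cyclic_decomposition_def)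
  then have "p (\<sigma> ! j ! t) = cycle_of_list (\<sigma> ! j) (\<sigma> ! j ! t)"
    using assms unfolding p by (intro foldr_cycle_of_list) auto
  also have "\<dots> = \<sigma> ! j ! (Suc t mod length (\<sigma> ! j))"
    using \<open>distinct (concat \<sigma>)\<close> assms by (intro cycle_of_list_nth) (auto simp: distinct_concat_iff)
  finally show ?thesis .
qed

lemma nth_nth_in_set_concat:
  "j < length \<sigma> \<Longrightarrow> t < length (\<sigma> ! j) \<Longrightarrow> \<sigma> ! j ! t \<in> set (concat \<sigma>)"
  unfolding set_concat by (meson UN_I nth_mem)

lemma nth_nth_eq_iff:
  assumes "distinct (concat \<sigma>)" and "i < length \<sigma>" "s < length (\<sigma> ! i)"
    and "j < length \<sigma>" "t < length (\<sigma> ! j)"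
  shows "\<sigma> ! i ! s = \<sigma> ! j ! t \<longleftrightarrow> i = j \<and> s = t"
  using assms
proof (induction \<sigma> arbitrary: i j)
  case (Cons c \<sigma>)
  have c: "distinct c" "distinct (concat \<sigma>)" using Cons.prems(1) by auto
  have notin: "\<sigma> ! k ! l \<noteq> c ! l'"
    if "k < length \<sigma>" "l < length (\<sigma> ! k)" "l' < length c" for k l l'
  proof -
    have "\<sigma> ! k ! l \<in> set (concat \<sigma>)" using that by (intro nth_nth_in_set_concat)
    moreover have "c ! l' \<in> set c" using that by simp
    moreover have "set c \<inter> set (concat \<sigma>) = {}" using Cons.prems(1) by simp
    ultimately show ?thesis by (metis disjoint_iff)
  qed
  show ?case
  proof (cases i)
    case 0
    then show ?thesis
      using Cons.prems notin c(1) by (cases j) (auto simp: nth_eq_iff_index_eq notin[symmetric])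
  next
    case i: (Suc i')
    then show ?thesis
      using Cons.prems Cons.IH[OF c(2), of i'] notin by (cases j) auto
  qed
qed simp

section \<open>Walk times as coordinates on the product\<close>

text \<open>The remainder of \<open>w\<close> is read off as the first component. Undoing the
  permutation \<open>Q (w mod m)\<close> on the second gives an element of \<open>V\<close>, which
  occurs at exactly one position of exactly one list and so determines \<open>j\<close> and
  \<open>w div m\<close>.\<close>

lemma bij_betw_cycle_coordinates:
  assumes dist: "distinct (concat \<sigma>)" and V: "set (concat \<sigma>) = V"
    and Q: "\<And>k. k < m \<Longrightarrow> Q k permutes V"
  shows "bij_betw (\<lambda>(j, w). (w mod m, Q (w mod m) (\<sigma> ! j ! (w div m))))
    (SIGMA j:{..<length \<sigma>}. {..<m * length (\<sigma> ! j)}) ({..<m} \<times> V)"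
    (is "bij_betw ?f ?A ?B")
proof -
  have div: "w div m < r" if "w < m * r" for w r
    using that by (simp add: less_mult_imp_div_less mult.commute)
  \<comment> \<open>An index below \<open>m * r\<close> can exist only for positive
    \<open>m\<close>; positivity puts \<open>w mod m\<close> in the range where \<open>Q\<close> is
    known to permute \<open>V\<close>.\<close>
  have m0: "0 < m" if "w < m * r" for w r using that by (cases m) auto
  have "inj_on ?f ?A"
  proof (clarsimp simp: inj_on_def)
    fix i v j w
    assume *: "i < length \<sigma>" "v < m * length (\<sigma> ! i)" "j < length \<sigma>" "w < m * length (\<sigma> ! j)"
      and mod: "v mod m = w mod m"
      and eq: "Q (w mod m) (\<sigma> ! i ! (v div m)) = Q (w mod m) (\<sigma> ! j ! (w div m))"
    have "inj (Q (w mod m))" using m0[OF *(2)] by (intro permutes_inj[OF Q]) simp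
    then have "\<sigma> ! i ! (v div m) = \<sigma> ! j ! (w div m)" using eq by (rule injD)
    then have "i = j \<and> v div m = w div m"
      using nth_nth_eq_iff[OF dist *(1) div[OF *(2)] *(3) div[OF *(4)]] by blast
    then show "i = j \<and> v = w" using mod by (metis div_mult_mod_eq)
  qed
  moreover have "?f ` ?A \<subseteq> ?B"
  proof clarsimp
    fix j w assume *: "j < length \<sigma>" "w < m * length (\<sigma> ! j)"
    then have "\<sigma> ! j ! (w div m) \<in> V" using div unfolding V[symmetric] by (intro nth_nth_in_set_concat)
    then show "w mod m < m \<and> Q (w mod m) (\<sigma> ! j ! (w div m)) \<in> V"
      using m0[OF *(2)] permutes_in_image[OF Q] by simp
  qed
  moreover have "?B \<subseteq> ?f ` ?A"
  proof clarsimp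
    fix i x assume i: "i < m" and "x \<in> V"
    then obtain y where y: "y \<in> V" "x = Q i y" using permutes_image[OF Q[OF i]] by blast
    then obtain j t where jt: "j < length \<sigma>" "t < length (\<sigma> ! j)" "y = \<sigma> ! j ! t"
      unfolding V[symmetric] by (auto simp: in_set_conv_nth)
    \<comment> \<open>The preimage of \<open>(i, x)\<close> is \<open>(j, i + m * t)\<close>, where
      \<open>t\<close> is the position of \<open>y\<close> in \<open>\<sigma> ! j\<close>; the chain
      shows that this time is in range.\<close>
    have "i + m * t < m + m * t" using i by simp
    also have "\<dots> = m * Suc t" by simp
    also have "\<dots> \<le> m * length (\<sigma> ! j)" using jt(2) by (intro mult_le_mono2) simp
    finally show "(i, x) \<in> ?f ` ?A"
      using i jt y(2) by (intro image_eqI[of _ _ "(j, i + m * t)"]) auto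
  qed
  ultimately show ?thesis unfolding bij_betw_def by blast
qed

section \<open>The isomorphism from the disjoint sum of cycles to the product\<close>

text \<open>The last property of \<Phi> ties summand \<open>j\<close> to the cycle
  \<open>\<sigma> ! j\<close> itself and not just to its length: the closed walk returns to the
  layer over \<open>a 1\<close> exactly at the elements of that cycle.\<close>

lemma otimes_oriented_cycle_iso:
  fixes a :: "nat \<Rightarrow> 'a" and h :: "'a \<times> 'a \<Rightarrow> 'v pair_pre_digraph"
  assumes "finite V"
    and h: "\<And>e. e \<in> parcs (oriented_cycle_on m a) \<Longrightarrow> one_regular (h e) \<and> pverts (h e) = V"
    and m: "m \<ge> 1" and inj: "inj_on a {1..m}"
    and \<sigma>: "cyclic_decomposition V (cycle_perm m a h) \<sigma>"
  defines "H \<equiv> otimes_digraph (oriented_cycle_on m a) V h"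
    and "Gs \<equiv> map (\<lambda>c. oriented_cycle (m * length c)) \<sigma>"
  obtains \<Phi> where "bij_betw \<Phi> (pverts (disjoint_sum Gs)) (pverts H)"
    and "parcs H = map_prod \<Phi> \<Phi> ` parcs (disjoint_sum Gs)"
    and "\<And>j. j < length \<sigma> \<Longrightarrow>
      (\<lambda>u. \<Phi> (j, u)) ` pverts (Gs ! j) \<inter> {a 1} \<times> V = {a 1} \<times> set (\<sigma> ! j)"
proof -
  define q where "q i = perm_of (h (a (Suc i), a (Suc (Suc i mod m))))" for i
  define Q where "Q k = fold (\<lambda>i p. q i \<circ> p) [0..<k] id" for k
  let ?I = "SIGMA j:{..<length \<sigma>}. {..<m * length (\<sigma> ! j)}"
  let ?\<Psi> = "\<lambda>(j, w). (w mod m, Q (w mod m) (\<sigma> ! j ! (w div m)))"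
  \<comment> \<open>The vertices of \<open>oriented_cycle k\<close> are 1, ..., \<open>k\<close>,
    whereas walk times start at 0; hence \<open>u - 1\<close>.\<close>
  let ?\<Phi> = "\<lambda>(j, u). map_prod (\<lambda>i. a (Suc i)) id (?\<Psi> (j, u - 1))"
  have len: "0 < length (\<sigma> ! j)" if "j < length \<sigma>" for j
    using \<sigma> that by (auto simp: cyclic_decomposition_def)
  have dist: "distinct (concat \<sigma>)" and V: "set (concat \<sigma>) = V"
    using \<sigma> by (auto simp: cyclic_decomposition_def)
  have arc: "one_regular (h (a (Suc i), a (Suc (Suc i mod m))))"
    "pverts (h (a (Suc i), a (Suc (Suc i mod m)))) = V" if "i < m" for i
    using h that by (auto simp: parcs_oriented_cycle_on[OF m])
  have q: "q i permutes V" if "i < m" for i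
    using perm_of_permutes[OF arc(1)] arc(2) that \<open>finite V\<close> unfolding q_def by simp
  have Q_Suc: "Q (Suc k) = q k \<circ> Q k" for k by (simp add: Q_def)
  have Q: "Q k permutes V" if "k \<le> m" for k
    using that
  proof (induction k)
    case 0
    have "Q 0 = id" by (simp add: Q_def)
    then show ?case using permutes_id by metis
  next
    case (Suc k)
    then have "Q k permutes V" "q k permutes V" using q by simp_all
    then show ?case unfolding Q_Suc by (rule permutes_compose)
  qed
  have Q_m: "cycle_perm m a h = Q m"
    by (simp add: cycle_perm_def cycle_arcs_conv[OF m] fold_map Q_def q_def comp_def)
  have inj': "inj_on (\<lambda>i. a (Suc i)) {..<m}"
  proof (rule inj_onI)
    fix i j assume "i \<in> {..<m}" "j \<in> {..<m}" "a (Suc i) = a (Suc j)"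
    then show "i = j" using inj_onD[OF inj, of "Suc i" "Suc j"] by simp
  qed

  have bij_\<Psi>: "bij_betw ?\<Psi> ?I ({..<m} \<times> V)"
    by (rule bij_betw_cycle_coordinates[OF dist V]) (simp add: Q)
  \<comment> \<open>One step along summand \<open>j\<close>, wrapping around at its full length,
    follows the arc that leaves the current vertex of the product.\<close>
  have step: "?\<Psi> (j, Suc w mod (m * length (\<sigma> ! j))) =
      (Suc (w mod m) mod m, q (w mod m) (Q (w mod m) (\<sigma> ! j ! (w div m))))"
    if "j < length \<sigma>" "w < m * length (\<sigma> ! j)" for j w
  proof (cases "Suc (w mod m) = m")
    \<comment> \<open>On the closing arc the composition is complete: \<open>Q m\<close> is the
      permutation being decomposed and moves to the next entry of \<open>\<sigma> ! j\<close>, from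
      which the next round starts with \<open>Q 0 = id\<close>. \<open>mod_mult2_eq\<close> splits
      the wrapped time so that the return from the last entry to the first is included.\<close>
    case True
    have "w div m < length (\<sigma> ! j)"
      using that(2) by (simp add: less_mult_imp_div_less mult.commute)
    then have "Q m (\<sigma> ! j ! (w div m)) = \<sigma> ! j ! (Suc (w div m) mod length (\<sigma> ! j))"
      using cyclic_decomposition_nth[OF \<sigma>] that(1) by (simp add: Q_m)
    then show ?thesis
      using True Q_Suc[of "w mod m"]
      by (simp add: mod_mult2_eq mod_Suc div_Suc Q_def[of 0])
  next
    case False
    \<comment> \<open>Wrapping could happen only at a multiple of \<open>m\<close>, so here
      \<open>w\<close> just increases by 1 and the list position stays the same.\<close>
    then have "Suc w mod m \<noteq> 0" by (simp add: mod_Suc)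
    then have "Suc w \<noteq> m * length (\<sigma> ! j)" by auto
    then have "Suc w mod (m * length (\<sigma> ! j)) = Suc w" using that(2) by simp
    then show ?thesis
      using False Q_Suc[of "w mod m"] m by (simp add: mod_Suc div_Suc)
  qed

  have len_Gs: "length Gs = length \<sigma>" by (simp add: Gs_def)
  have "pverts (Gs ! j) = Suc ` {..<m * length (\<sigma> ! j)}" if "j < length \<sigma>" for j
    using that by (simp add: Gs_def oriented_cycle_def pverts_oriented_cycle_on)
  then have pverts_sum: "pverts (disjoint_sum Gs) = (\<lambda>(j, w). (j, Suc w)) ` ?I"
    unfolding image_Sigma_conv_UN pverts_disjoint_sum len_Gs
    by (intro SUP_cong) (simp_all only: image_image lessThan_iff)
  have "parcs (Gs ! j) =
      (\<lambda>w. (Suc w, Suc (Suc w mod (m * length (\<sigma> ! j))))) ` {..<m * length (\<sigma> ! j)}"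
    if "j < length \<sigma>" for j
    using that m len[OF that]
    by (simp add: Gs_def oriented_cycle_def parcs_oriented_cycle_on Suc_leI)
  then have parcs_sum: "parcs (disjoint_sum Gs) =
      (\<lambda>(j, w). ((j, Suc w), (j, Suc (Suc w mod (m * length (\<sigma> ! j)))))) ` ?I"
    unfolding image_Sigma_conv_UN parcs_disjoint_sum len_Gs
    by (intro SUP_cong) (simp_all only: image_image lessThan_iff map_prod_simp)
  have pverts_H: "pverts H = map_prod (\<lambda>i. a (Suc i)) id ` ({..<m} \<times> V)"
    by (force simp: H_def otimes_digraph_def pverts_oriented_cycle_on)
  \<comment> \<open>Each value of \<open>h\<close> on the cycle is the graph of a permutation, so
    the arcs of the product can be indexed by their tails.\<close>
  have parcs_H: "parcs H =
      (\<lambda>(i, x). ((a (Suc i), x), (a (Suc (Suc i mod m)), q i x))) ` ({..<m} \<times> V)"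
  proof -
    have "(u, v) \<in> parcs H \<longleftrightarrow>
        (\<exists>i<m. \<exists>x\<in>V. u = (a (Suc i), x) \<and> v = (a (Suc (Suc i mod m)), q i x))" for u v
      using arc(2) one_regular_arc_iff[OF arc(1)]
      by (cases u; cases v)
        (auto simp: H_def otimes_digraph_def parcs_oriented_cycle_on[OF m] q_def)
    then show ?thesis by (auto simp: image_iff)
  qed

  show thesis
  proof
    have "bij_betw (map_prod (\<lambda>i. a (Suc i)) id) ({..<m} \<times> V) (pverts H)"
      unfolding pverts_H using inj' by (intro inj_on_imp_bij_betw map_prod_inj_on) auto
    with bij_\<Psi> have "bij_betw (map_prod (\<lambda>i. a (Suc i)) id \<circ> ?\<Psi>) ?I (pverts H)"
      by (rule bij_betw_trans)
    also have "map_prod (\<lambda>i. a (Suc i)) id \<circ> ?\<Psi> = ?\<Phi> \<circ> (\<lambda>(j, w). (j, Suc w))"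
      by (auto simp: fun_eq_iff)
    finally have comp: "bij_betw (?\<Phi> \<circ> (\<lambda>(j, w). (j, Suc w))) ?I (pverts H)" .
    \<comment> \<open>The shift from times to vertices is a bijection and so is its composite with
      \<Phi>, hence \<Phi> is one too.\<close>
    have "bij_betw (\<lambda>(j, w). (j, Suc w)) ?I (pverts (disjoint_sum Gs))"
      unfolding pverts_sum by (intro inj_on_imp_bij_betw) (auto simp: inj_on_def)
    from bij_betw_comp_iff[OF this] comp
    show "bij_betw ?\<Phi> (pverts (disjoint_sum Gs)) (pverts H)" by (rule iffD2)
  next
    \<comment> \<open>By \<open>step\<close>, \<Phi> sends the arc leaving time \<open>w\<close> of
      summand \<open>j\<close> to the product arc with tail coordinates
      \<open>?\<Psi> (j, w)\<close>; since \<Psi> is onto, every arc of \<open>H\<close>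
      arises.\<close>
    have "map_prod ?\<Phi> ?\<Phi> ` parcs (disjoint_sum Gs) =
        (\<lambda>(i, x). ((a (Suc i), x), (a (Suc (Suc i mod m)), q i x))) ` ?\<Psi> ` ?I"
      unfolding parcs_sum image_image
    proof (rule image_cong[OF refl])
      fix v assume "v \<in> ?I"
      then obtain j w where v: "v = (j, w)" "j < length \<sigma>" "w < m * length (\<sigma> ! j)" by auto
      show "map_prod ?\<Phi> ?\<Phi>
            (case v of (j, w) \<Rightarrow> ((j, Suc w), (j, Suc (Suc w mod (m * length (\<sigma> ! j)))))) =
          (\<lambda>(i, x). ((a (Suc i), x), (a (Suc (Suc i mod m)), q i x))) (?\<Psi> v)"
        using step[OF v(2,3)]
        unfolding v(1) map_prod_simp case_prod_conv diff_Suc_1 id_apply prod.inject by metis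
    qed
    then show "parcs H = map_prod ?\<Phi> ?\<Phi> ` parcs (disjoint_sum Gs)"
      unfolding parcs_H bij_betw_imp_surj_on[OF bij_\<Psi>] by simp
  next
    fix j assume j: "j < length \<sigma>"
    have *: "(\<lambda>u. ?\<Phi> (j, u)) ` pverts (Gs ! j) =
        (\<lambda>w. (a (Suc (w mod m)), Q (w mod m) (\<sigma> ! j ! (w div m)))) ` {..<m * length (\<sigma> ! j)}"
      using j by (simp add: Gs_def oriented_cycle_def pverts_oriented_cycle_on image_image)
    \<comment> \<open>By injectivity of \<open>a\<close>, the walk is over \<open>a 1\<close>
      exactly at multiples of \<open>m\<close>. There the composition is \<open>Q 0 = id\<close>, so
      the second component at time \<open>m * t\<close> is entry \<open>t\<close> of the
      list.\<close>
    have a1: "a (Suc (w mod m)) = a 1 \<longleftrightarrow> w mod m = 0" for w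
      using inj_on_eq_iff[OF inj', of "w mod m" 0] m by simp
    have Q0: "Q 0 = id" by (simp add: Q_def)
    show "(\<lambda>u. ?\<Phi> (j, u)) ` pverts (Gs ! j) \<inter> {a 1} \<times> V = {a 1} \<times> set (\<sigma> ! j)"
      unfolding *
    proof (intro equalityI subsetI)
      fix v assume "v \<in> {a 1} \<times> set (\<sigma> ! j)"
      then obtain t where t: "t < length (\<sigma> ! j)" "v = (a 1, \<sigma> ! j ! t)"
        by (auto simp: in_set_conv_nth)
      then have "v \<in> {a 1} \<times> V" using nth_nth_in_set_concat[OF j t(1)] unfolding V by simp
      with t m show "v \<in> (\<lambda>w. (a (Suc (w mod m)), Q (w mod m) (\<sigma> ! j ! (w div m))))
          ` {..<m * length (\<sigma> ! j)} \<inter> {a 1} \<times> V"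
        by (auto simp: Q0 intro!: image_eqI[of _ _ "m * t"])
    next
      fix v
      assume "v \<in> (\<lambda>w. (a (Suc (w mod m)), Q (w mod m) (\<sigma> ! j ! (w div m))))
          ` {..<m * length (\<sigma> ! j)} \<inter> {a 1} \<times> V"
      then obtain w where w: "w < m * length (\<sigma> ! j)"
          "v = (a (Suc (w mod m)), Q (w mod m) (\<sigma> ! j ! (w div m)))"
        and "a (Suc (w mod m)) = a 1" by auto
      then have "w mod m = 0" by (simp only: a1)
      moreover have "w div m < length (\<sigma> ! j)"
        using w(1) by (simp add: less_mult_imp_div_less mult.commute)
      ultimately show "v \<in> {a 1} \<times> set (\<sigma> ! j)" using w(2) by (simp add: Q0)
    qed
  qed
qed

section \<open>Strong components of the product and cycles of the permutation\<close>

theorem theorem2p6: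
  fixes m n :: nat and a :: "nat \<Rightarrow> 'a" and V :: "'v set"
    and \<Gamma> :: "'v pair_pre_digraph set"
    and h :: "'a \<times> 'a \<Rightarrow> 'v pair_pre_digraph"
    and \<sigma> :: "'v list list"
  assumes "finite V" and "card V = n"
    and "\<forall>F \<in> \<Gamma>. one_regular F \<and> pverts F = V"
    and "m \<ge> 1" and "inj_on a {1..m}"
    and "h \<in> parcs (oriented_cycle_on m a) \<rightarrow> \<Gamma>"
    and "cyclic_decomposition V (cycle_perm m a h) \<sigma>"
  shows "(\<exists>K. bij_betw K {..<length \<sigma>}
                (pre_digraph.sccs (with_proj (otimes_digraph (oriented_cycle_on m a) V h))) \<and>
              (\<forall>j < length \<sigma>.
                 verts (K j) \<inter> ({a 1} \<times> V) = {a 1} \<times> set (\<sigma> ! j) \<and>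
                 digraph_iso (K j) (with_proj (oriented_cycle (m * length (\<sigma> ! j)))))) \<and>
         digraph_iso (with_proj (otimes_digraph (oriented_cycle_on m a) V h))
           (with_proj (disjoint_sum (map (\<lambda>c. oriented_cycle (m * length c)) \<sigma>)))"
proof -
  let ?H = "otimes_digraph (oriented_cycle_on m a) V h"
  let ?Gs = "map (\<lambda>c. oriented_cycle (m * length c)) \<sigma>"
  have "one_regular (h e) \<and> pverts (h e) = V" if "e \<in> parcs (oriented_cycle_on m a)" for e
    using assms(3,6) that by (blast dest: funcset_mem)
  then obtain \<Phi> where \<Phi>: "bij_betw \<Phi> (pverts (disjoint_sum ?Gs)) (pverts ?H)"
      "parcs ?H = map_prod \<Phi> \<Phi> ` parcs (disjoint_sum ?Gs)"
    and base: "\<And>j. j < length \<sigma> \<Longrightarrow>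
      (\<lambda>u. \<Phi> (j, u)) ` pverts (?Gs ! j) \<inter> {a 1} \<times> V = {a 1} \<times> set (\<sigma> ! j)"
    using otimes_oriented_cycle_iso[OF assms(1) _ assms(4,5,7)] by blast
  define K where "K j = with_proj ?H \<restriction> (\<lambda>u. \<Phi> (j, u)) ` pverts (?Gs ! j)" for j
  have "\<sigma> ! j \<noteq> []" if "j < length \<sigma>" for j
    using assms(7) that by (auto simp: cyclic_decomposition_def)
  \<comment> \<open>Nonempty lists and \<open>m \<ge> 1\<close> exclude length 0, for which
    \<open>oriented_cycle\<close> is not a meaningful cycle.\<close>
  then have pos: "1 \<le> m * length (\<sigma> ! j)" if "j < length \<sigma>" for j
    using assms(4) that by (simp add: Suc_le_eq)
  have wf: "pair_wf_digraph (?Gs ! j)" if "j < length ?Gs" for j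
    using that pos by (simp add: pair_wf_oriented_cycle)
  have sc: "strongly_connected (with_proj (?Gs ! j))" if "j < length ?Gs" for j
    using that pos by (simp add: strongly_connected_oriented_cycle)
  note K = sccs_of_disjoint_sum_image[OF wf sc \<Phi>, folded K_def]
  have "bij_betw K {..<length \<sigma>} (pre_digraph.sccs (with_proj ?H))"
    using K(1) by simp
  moreover have "digraph_iso (K j) (with_proj (oriented_cycle (m * length (\<sigma> ! j))))"
    if "j < length \<sigma>" for j
    using K(2)[of j] that by simp
  moreover have "verts (K j) \<inter> ({a 1} \<times> V) = {a 1} \<times> set (\<sigma> ! j)" if "j < length \<sigma>" for j
    using base[OF that] by (simp add: K_def)
  moreover have "digraph_iso (with_proj ?H) (with_proj (disjoint_sum ?Gs))"
  \<comment> \<open>The map \<Phi> runs from the sum to the product, opposite to the claimed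
    direction.\<close>
  proof (rule digraph_iso_swap)
    interpret pair_wf_digraph "disjoint_sum ?Gs" using wf by (rule pair_wf_disjoint_sum)
    show "wf_digraph (with_proj (disjoint_sum ?Gs))" by (rule wf_digraph)
    show "digraph_iso (with_proj (disjoint_sum ?Gs)) (with_proj ?H)"
      using pair_wf_disjoint_sum[OF wf] \<Phi> by (rule digraph_iso_with_projI)
  qed
  ultimately show ?thesis by blast
qed

end
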